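(* Fix $\alpha_1,\alpha_2,\alpha_3,\alpha_4\in\mathbb{R}^+$, and let $n_1,n_2,n_3,n_4$ be positive integers (varying along a sequence) with, without loss of generality, $n_1\ge n_2$ and $n_3\ge n_4$. Consider the inequality $$p_{\alpha_1}(n_1)\,p_{\alpha_2}(n_2)\ \ge\ p_{\alpha_3}(n_3)\,p_{\alpha_4}(n_4).$$ If $n_3=o(n_1)$ (as $n_1\to\infty$), then the inequality is true for $n_1$ sufficiently large. Conversely, if $n_1=o(n_3)$ (as $n_3\to\infty$), then the inequality is false for $n_3$ sufficiently large.
   Context: For real $\alpha>0$, the numbers $p_\alpha(n)$ ($n\ge 0$) are defined by the power series identity $\prod_{m\ge1}(1-q^m)^{-\alpha}=\sum_{n\ge0}p_\alpha(n)q^n$ (for $|q|<1$, with the branch having constant term $1$). The asymptotic hypotheses are read for sequences of quadruples: given sequences of positive integers $n_i=n_i(t)$, $t=1,2,\dots$, $i=1,\dots,4$, with $n_1(t)\ge n_2(t)$ and $n_3(t)\ge n_4(t)$ for all $t$, "$n_3=o(n_1)$" means $n_1(t)\to\infty$ and $n_3(t)/n_1(t)\to0$ as $t\to\infty$, and the conclusion is that the inequality holds for all sufficiently large $t$; similarly for the converse statement with $n_3(t)\to\infty$ and $n_1(t)/n_3(t)\to 0$, where the conclusion is that the inequality fails for all sufficiently large $t$. *)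

theory Defs
  imports "HOL-Complex_Analysis.Complex_Analysis"
begin

text \<open>
  The complex \<open>powr\<close> uses the principal logarithm; since \<open>1 - q ^ m\<close> has positive real part for
  \<open>norm q < 1\<close> and \<open>m > 0\<close>, the product is the branch that is holomorphic in the unit disc with
  value 1 at 0. The index is shifted: the factor at \<open>m\<close> is the one for \<open>m + 1\<close>.
\<close>
definition pgen :: "real \<Rightarrow> complex \<Rightarrow> complex" where
  "pgen \<alpha> q = (\<Prod>m. (1 - q ^ Suc m) powr (- complex_of_real \<alpha>))"

definition pnum :: "real \<Rightarrow> nat \<Rightarrow> real" where
  "pnum \<alpha> = (THE c. \<forall>q. norm q < 1 \<longrightarrow>
     (\<lambda>n. complex_of_real (c n) * q ^ n) sums pgen \<alpha> q)"

lemma one_minus_power_notin_nonpos_Reals: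
  fixes q :: complex
  assumes "norm q < 1"
  shows "1 - q ^ Suc m \<notin> \<real>\<^sub>\<le>\<^sub>0"
proof -
  have "norm (q ^ Suc m) < 1"
    unfolding norm_power using assms by (subst power_less_one_iff) auto
  then have "Re (q ^ Suc m) < 1"
    using complex_Re_le_cmod order_le_less_trans by blast
  then have "Re (1 - q ^ Suc m) > 0"
    by simp
  then show ?thesis
    by (auto simp: complex_nonpos_Reals_iff)
qed

lemma pgen_factor:
  fixes q :: complex
  assumes "norm q < 1"
  shows "(1 - q ^ Suc m) powr (- complex_of_real \<alpha>) =
           exp (- complex_of_real \<alpha> * Ln (1 - q ^ Suc m))"
proof -
  have "1 - q ^ Suc m \<noteq> 0"
    using one_minus_power_notin_nonpos_Reals[OF assms, of m] by (metis nonpos_Reals_zero_I)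
  then show ?thesis
    by (simp add: powr_def)
qed

lemma pgen_log_series:
  obtains g where "\<And>q. norm q < 1 \<Longrightarrow> (\<lambda>m. - complex_of_real \<alpha> * Ln (1 - q ^ Suc m)) sums g q"
    and "g holomorphic_on ball 0 1"
proof -
  let ?f = "\<lambda>m q. - complex_of_real \<alpha> * Ln (1 - q ^ Suc m)"
  let ?D = "\<lambda>m q. deriv (?f m) q"
  have "\<exists>g g'. \<forall>x\<in>ball 0 1. (\<lambda>n. ?f n x) sums g x \<and> (\<lambda>n. ?D n x) sums g' x \<and>
            (g has_field_derivative g' x) (at x)"
  proof (rule series_and_derivative_comparison_local)
    fix n :: nat and x :: complex assume x: "x \<in> ball 0 1"
    have "?f n holomorphic_on ball 0 1"
    proof (intro holomorphic_on_mult holomorphic_on_const holomorphic_on_Ln' holomorphic_on_diff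
        holomorphic_on_power holomorphic_on_ident)
      fix z :: complex assume "z \<in> ball 0 1"
      then show "1 - z ^ Suc n \<notin> \<real>\<^sub>\<le>\<^sub>0"
        by (intro one_minus_power_notin_nonpos_Reals) simp
    qed
    then have "(?f n) field_differentiable (at x)"
      using x by (intro holomorphic_on_imp_differentiable_at[of _ "ball 0 1"]) auto
    then show "(?f n has_field_derivative ?D n x) (at x)"
      using field_differentiable_derivI by blast
  next
    fix x :: complex assume "x \<in> ball 0 1"
    then have x: "norm x < 1" by simp
    define r where "r = (1 + norm x) / 2"
    have r: "0 < r" "r < 1" "norm x < r" using x by (auto simp: r_def add_pos_nonneg)
    define h where "h = (\<lambda>n::nat. \<bar>\<alpha>\<bar> * (2 * r ^ Suc n))"
    have "summable (\<lambda>n. r ^ Suc n)"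
      using r by (simp add: summable_mult summable_geometric)
    then have sh: "summable h"
      unfolding h_def by (intro summable_mult)
    have "(\<lambda>n. r ^ Suc n) \<longlonglongrightarrow> 0"
      by (rule summable_LIMSEQ_zero) fact
    then have "\<forall>\<^sub>F n in sequentially. r ^ Suc n < 1/2"
      by (rule order_tendstoD) auto
    then have "\<forall>\<^sub>F n in sequentially. \<forall>y\<in>ball x (r - norm x) \<inter> ball 0 1. norm (?f n y) \<le> h n"
    proof eventually_elim
      case (elim n)
      show ?case
      proof
        fix y assume "y \<in> ball x (r - norm x) \<inter> ball 0 1"
        then have "norm (y - x) < r - norm x"
          by (simp add: dist_norm norm_minus_commute)
        then have "norm y \<le> r"
          using norm_triangle_ineq2[of y x] by linarith
        then have y: "norm (- (y ^ Suc n)) \<le> r ^ Suc n"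
          unfolding norm_minus_cancel norm_power by (intro power_mono) auto
        have "norm (Ln (1 + - (y ^ Suc n))) \<le> 2 * norm (- (y ^ Suc n))"
          by (rule norm_Ln_le) (use y elim in linarith)
        also have "\<dots> \<le> 2 * r ^ Suc n"
          using y by simp
        finally show "norm (?f n y) \<le> h n"
          unfolding h_def norm_mult norm_minus_cancel norm_of_real
          by (intro mult_left_mono) simp_all
      qed
    qed
    then show "\<exists>d h. 0 < d \<and> summable h \<and>
        (\<forall>\<^sub>F n in sequentially. \<forall>y\<in>ball x d \<inter> ball 0 1. norm (?f n y) \<le> h n)"
      using r(3) sh by (intro exI[of _ "r - norm x"] exI[of _ h]) simp
  qed auto
  then obtain g g' where g: "\<And>x. x \<in> ball 0 1 \<Longrightarrow> (\<lambda>n. ?f n x) sums g x"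
      "\<And>x. x \<in> ball 0 1 \<Longrightarrow> (g has_field_derivative g' x) (at x)"
    by blast
  show thesis
  proof (rule that[of g])
    show "g holomorphic_on ball 0 1"
      using g(2) unfolding holomorphic_on_open[OF open_ball] by blast
  qed (use g(1) in auto)
qed

lemma pgen_holomorphic_has_prod:
  shows pgen_holomorphic: "pgen \<alpha> holomorphic_on ball 0 1"
    and pgen_has_prod: "norm q < 1 \<Longrightarrow>
          (\<lambda>m. (1 - q ^ Suc m) powr (- complex_of_real \<alpha>)) has_prod pgen \<alpha> q"
proof -
  obtain g where g: "\<And>q. norm q < 1 \<Longrightarrow> (\<lambda>m. - complex_of_real \<alpha> * Ln (1 - q ^ Suc m)) sums g q"
    and hol: "g holomorphic_on ball 0 1"
    using pgen_log_series[of \<alpha>] by blast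
  have *: "(\<lambda>m. (1 - q ^ Suc m) powr (- complex_of_real \<alpha>)) has_prod exp (g q)"
    if "norm q < 1" for q
    unfolding pgen_factor[OF that] using sums_imp_has_prod_exp[OF g[OF that]]
    by (simp add: has_prod_def)
  have eq: "pgen \<alpha> q = exp (g q)" if "norm q < 1" for q
    unfolding pgen_def using has_prod_unique[OF *[OF that]] by simp
  show "norm q < 1 \<Longrightarrow> (\<lambda>m. (1 - q ^ Suc m) powr (- complex_of_real \<alpha>)) has_prod pgen \<alpha> q"
    using * eq by simp
  have "(\<lambda>q. exp (g q)) holomorphic_on ball 0 1"
    by (intro holomorphic_intros hol)
  then show "pgen \<alpha> holomorphic_on ball 0 1"
    by (rule holomorphic_transform) (simp add: eq)
qed

lemma pgen_cnj:
  assumes "norm q < 1"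
  shows "pgen \<alpha> (cnj q) = cnj (pgen \<alpha> q)"
proof -
  let ?a = "\<lambda>q m. (1 - q ^ Suc m) powr (- complex_of_real \<alpha>)"
  have cnj: "cnj (?a q m) = ?a (cnj q) m" for m
  proof -
    have "Re (1 - q ^ Suc m) \<ge> 0" if "Im (1 - q ^ Suc m) = 0"
      using one_minus_power_notin_nonpos_Reals[OF assms, of m] that
      by (auto simp: complex_nonpos_Reals_iff)
    then show ?thesis
      by (subst cnj_powr) auto
  qed
  have lim: "(\<lambda>n. \<Prod>m\<le>n. ?a q m) \<longlonglongrightarrow> pgen \<alpha> q" if "norm q < 1" for q
    using pgen_has_prod[OF that, of \<alpha>] has_prod_imp_tendsto by blast
  have "(\<lambda>n. cnj (\<Prod>m\<le>n. ?a q m)) \<longlonglongrightarrow> cnj (pgen \<alpha> q)"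
    by (intro tendsto_cnj lim assms)
  then have "(\<lambda>n. \<Prod>m\<le>n. ?a (cnj q) m) \<longlonglongrightarrow> cnj (pgen \<alpha> q)"
    by (simp only: cnj_prod cnj)
  moreover have "(\<lambda>n. \<Prod>m\<le>n. ?a (cnj q) m) \<longlonglongrightarrow> pgen \<alpha> (cnj q)"
    by (rule lim) (use assms in simp)
  ultimately show ?thesis
    using LIMSEQ_unique by blast
qed

lemma pgen_coeffs_unique:
  fixes a b :: "nat \<Rightarrow> complex"
  assumes "\<And>q. norm q < 1 \<Longrightarrow> (\<lambda>n. a n * q ^ n) sums pgen \<alpha> q"
    and "\<And>q. norm q < 1 \<Longrightarrow> (\<lambda>n. b n * q ^ n) sums pgen \<alpha> q"
  shows "a = b"
proof -
  have ev: "\<forall>\<^sub>F q in nhds (0::complex). norm q < 1"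
    using eventually_nhds_in_open[of "ball 0 1" "0::complex"] by simp
  have "pgen \<alpha> has_fps_expansion Abs_fps a"
    by (rule has_fps_expansionI, rule eventually_mono[OF ev]) (simp add: assms)
  moreover have "pgen \<alpha> has_fps_expansion Abs_fps b"
    by (rule has_fps_expansionI, rule eventually_mono[OF ev]) (simp add: assms)
  ultimately have "Abs_fps a = Abs_fps b"
    by (rule fps_expansion_unique_complex)
  then show ?thesis
    by (simp add: fps_eq_iff fun_eq_iff)
qed

text \<open>The defining identity holds, so the definite description above is not vacuous.\<close>

theorem pnum_sums:
  assumes "norm q < 1"
  shows "(\<lambda>n. complex_of_real (pnum \<alpha> n) * q ^ n) sums pgen \<alpha> q"
proof -
  define c where "c = (\<lambda>n. (deriv ^^ n) (pgen \<alpha>) 0 / fact n)"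
  have c: "(\<lambda>n. c n * q ^ n) sums pgen \<alpha> q" if "norm q < 1" for q
    using holomorphic_power_series[OF pgen_holomorphic[of \<alpha>], of q] that
    by (simp add: c_def)
  have "(\<lambda>n. cnj (c n) * q ^ n) sums pgen \<alpha> q" if "norm q < 1" for q
  proof -
    have "(\<lambda>n. c n * cnj q ^ n) sums pgen \<alpha> (cnj q)"
      by (rule c) (use that in simp)
    then have "(\<lambda>n. cnj (c n * cnj q ^ n)) sums cnj (pgen \<alpha> (cnj q))"
      by (simp only: sums_cnj)
    then show ?thesis
      using that by (simp add: pgen_cnj)
  qed
  then have "(\<lambda>n. cnj (c n)) = c"
    using c by (rule pgen_coeffs_unique)
  then have re: "complex_of_real (Re (c n)) = c n" for n
    by (metis Reals_cnj_iff of_real_Re)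
  let ?P = "\<lambda>c. \<forall>q. norm q < 1 \<longrightarrow> (\<lambda>n. complex_of_real (c n) * q ^ n) sums pgen \<alpha> q"
  have "?P (pnum \<alpha>)"
    unfolding pnum_def
  proof (rule theI[where P = ?P])
    show "?P (\<lambda>n. Re (c n))"
      using c by (simp add: re)
  next
    fix d assume "?P d"
    then have "(\<lambda>n. complex_of_real (d n)) = c"
      using c by (intro pgen_coeffs_unique[of _ \<alpha>]) auto
    then show "d = (\<lambda>n. Re (c n))"
      by (metis Re_complex_of_real)
  qed
  with assms show ?thesis
    by blast
qed

end

theory Submission
  imports Defs
begin

text \<open>
  Writing \<open>\<sigma>(n) / n\<close> as the sum of \<open>1 / k\<close> over the divisors \<open>k\<close> of \<open>n\<close>, the generating function is
  \<open>exp (\<alpha> * (\<Sum>n. \<sigma>(n) / n * q ^ n))\<close>. Its logarithmic derivative gives the recurrence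
  \<open>n * p(n) = \<alpha> * (\<Sum>k=1..n. \<sigma>(k) * p(n - k))\<close>, from which \<open>\<sigma>(k) \<ge> k\<close> and induction yield
  \<open>p(n) \<ge> \<delta> * exp (c * sqrt n)\<close>. Conversely \<open>p(n) * r ^ n\<close> is at most the generating function at \<open>r\<close>,
  whose logarithm is at most a constant times \<open>r / (1 - r)\<close>; taking \<open>r = 1 / (1 + 1 / sqrt n)\<close> gives
  \<open>p(n) \<le> exp (C * sqrt n)\<close>. So each product in the theorem is exponential in the square root of its
  larger argument, whatever the parameters.
\<close>

section \<open>Divisor sums and the Lambert double series\<close>

text \<open>At 0 the index set is infinite, so the sum has the junk value 0.\<close>
definition inv_div_sum :: "nat \<Rightarrow> real" where
  "inv_div_sum n = (\<Sum>k | k dvd n. 1 / real k)"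

lemma inv_div_sum_0 [simp]: "inv_div_sum 0 = 0"
  by (simp add: inv_div_sum_def)

lemma inv_div_sum_ge_1:
  assumes "n > 0"
  shows "inv_div_sum n \<ge> 1"
proof -
  have "(\<Sum>k\<in>{1}. 1 / real k) \<le> (\<Sum>k | k dvd n. 1 / real k)"
    using assms by (intro sum_mono2) auto
  then show ?thesis
    by (simp add: inv_div_sum_def)
qed

text \<open>Factor \<open>1 - r ^ k\<close> as \<open>1 - r\<close> times the sum of
  \<open>r ^ i\<close> over \<open>i < k\<close>; each of the \<open>k\<close> summands is at least
  \<open>r ^ (k - 1)\<close>. After division by \<open>k\<close>, the right-hand side carries
  \<open>1 / k ^ 2\<close>, which makes the Lambert series converge with an explicit bound.\<close>

lemma geometric_quotient_le:
  fixes r :: real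
  assumes "0 \<le> r" "r < 1" "k > 0"
  shows "r ^ k / (1 - r ^ k) \<le> r / (real k * (1 - r))"
proof -
  have "real k * r ^ (k - 1) = (\<Sum>i<k. r ^ (k - 1))"
    by simp
  also have "\<dots> \<le> (\<Sum>i<k. r ^ i)"
    using assms by (intro sum_mono power_decreasing) auto
  finally have "(1 - r) * (real k * r ^ (k - 1)) \<le> 1 - r ^ k"
    using assms by (subst one_diff_power_eq) (intro mult_left_mono, auto)
  then have "r * ((1 - r) * (real k * r ^ (k - 1))) \<le> r * (1 - r ^ k)"
    using assms(1) by (rule mult_left_mono)
  moreover have "r * r ^ (k - 1) = r ^ k"
    using assms(3) by (simp flip: power_Suc)
  ultimately have "r ^ k * (real k * (1 - r)) \<le> r * (1 - r ^ k)"
    by (metis mult.assoc mult.commute)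
  moreover have "r ^ k < 1"
    using assms by (simp add: power_less_one_iff)
  ultimately show ?thesis
    using assms by (simp add: frac_le_eq field_simps)
qed

text \<open>Summing over \<open>m\<close> first gives a geometric series for each \<open>k\<close>,
  and \<open>geometric_quotient_le\<close> compares the results with a multiple of
  \<open>1 / k ^ 2\<close>. All terms are nonnegative, so summability of the iterated sum yields
  summability over the product.\<close>

lemma lambert_has_sum:
  fixes r :: real
  assumes "0 \<le> r" "r < 1"
  obtains S where "((\<lambda>(k, m). r ^ (Suc m * k) / real k) has_sum S) (UNIV \<times> UNIV)"
    and "S \<le> (\<Sum>k. 1 / real k ^ 2) * (r / (1 - r))"
proof -
  let ?f = "\<lambda>(k, m). r ^ (Suc m * k) / real k"
  let ?g = "\<lambda>k. r ^ k / (1 - r ^ k) / real k"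
  let ?h = "\<lambda>k. 1 / real k ^ 2 * (r / (1 - r))"
  have inner: "((\<lambda>m. ?f (k, m)) has_sum ?g k) UNIV" for k
  \<comment> \<open>The index \<open>k = 0\<close> contributes nothing, since division by 0 gives 0
    on both sides.\<close>
  proof (cases "k = 0")
    case False
    then have "norm (r ^ k) < 1"
      using assms by (simp add: power_less_one_iff)
    then have "(\<lambda>m. r ^ k * (r ^ k) ^ m / real k) sums (r ^ k * (1 / (1 - r ^ k)) / real k)"
      by (intro sums_divide sums_mult geometric_sums)
    then have "(\<lambda>m. ?f (k, m)) sums ?g k"
      by (simp add: power_add mult.commute flip: power_mult)
    then show ?thesis
      by (rule sums_nonneg_imp_has_sum) (use assms in auto)
  qed simp
  have gh: "?g k \<le> ?h k" for k
  proof (cases "k = 0")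
    case False
    then show ?thesis
      using divide_right_mono[OF geometric_quotient_le[OF assms, of k], of "real k"]
      by (simp add: power2_eq_square mult_ac)
  qed simp
  have g0: "?g k \<ge> 0" for k
    using assms by (simp add: power_le_one)
  have "summable (\<lambda>k. 1 / real k ^ 2)"
    using inverse_power_summable[of 2, where 'a = real] by (simp add: inverse_eq_divide)
  then have h: "?h sums ((\<Sum>k. 1 / real k ^ 2) * (r / (1 - r)))"
    by (intro sums_mult2 summable_sums)
  have sg: "summable ?g"
    by (rule summable_comparison_test'[OF sums_summable[OF h], of 0])
      (use g0 gh in \<open>simp only: real_norm_def abs_of_nonneg\<close>)
  have hs: "(?g has_sum (\<Sum>k. ?g k)) UNIV"
    by (rule sums_nonneg_imp_has_sum[OF summable_sums[OF sg] g0])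
  show thesis
  proof
    show "(?f has_sum (\<Sum>k. ?g k)) (UNIV \<times> UNIV)"
    proof (rule has_sum_SigmaI[OF _ hs])
      show "?f summable_on UNIV \<times> UNIV"
        by (rule summable_on_SigmaI[OF inner has_sum_imp_summable[OF hs]])
          (use assms in auto)
    qed (rule inner)
    show "(\<Sum>k. ?g k) \<le> (\<Sum>k. 1 / real k ^ 2) * (r / (1 - r))"
      unfolding sums_unique[OF h] by (rule suminf_le[OF gh sg sums_summable[OF h]])
  qed
qed

text \<open>One unconditional double sum is evaluated in two ways. Summing over \<open>k\<close> for
  fixed \<open>m\<close> gives the logarithm series of \<open>1 - q ^ Suc m\<close>; grouping the
  terms by the exponent \<open>n = Suc m * k\<close> collects \<open>1 / k\<close> over the divisors
  \<open>k\<close> of \<open>n\<close>.\<close>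

lemma lambert_sums:
  fixes q :: complex
  assumes q: "norm q < 1"
    and S: "((\<lambda>(k, m). q ^ (Suc m * k) / of_nat k) has_sum S) (UNIV \<times> UNIV)"
  shows "(\<lambda>m. - Ln (1 - q ^ Suc m)) sums S"
    and "(\<lambda>n. of_real (inv_div_sum n) * q ^ n) sums S"
proof -
  let ?f = "\<lambda>(k, m). q ^ (Suc m * k) / of_nat k"
  have "((\<lambda>m. - Ln (1 - q ^ Suc m)) has_sum S) UNIV"
  proof (rule has_sum_SigmaD)
    show "((\<lambda>(m, k). ?f (k, m)) has_sum S) (UNIV \<times> UNIV)"
      using S by (subst (asm) has_sum_swap) simp
    fix m
    define z where "z = q ^ Suc m"
    have z: "norm z < 1"
      unfolding z_def norm_power using q by (subst power_less_one_iff) auto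
    have "(\<lambda>k. - (z ^ k / of_nat k)) sums Ln (1 - z)"
      using Ln_series'[of "-z"] z by simp
    then have "(\<lambda>k. z ^ k / of_nat k) sums - Ln (1 - z)"
      using sums_minus by fastforce
    moreover have "summable (\<lambda>k. norm (z ^ k / of_nat k))"
    proof (rule summable_comparison_test')
      show "summable (\<lambda>k. norm z ^ k)"
        using z by (simp add: summable_geometric)
      fix k :: nat
      show "norm (norm (z ^ k / of_nat k)) \<le> norm z ^ k"
        by (cases "k = 0") (auto simp: norm_divide norm_power divide_le_eq mult_le_cancel_left1)
    qed
    ultimately have "((\<lambda>k. z ^ k / of_nat k) has_sum - Ln (1 - z)) UNIV"
      by (intro norm_summable_imp_has_sum)
    then show "((\<lambda>k. case (m, k) of (m, k) \<Rightarrow> ?f (k, m)) has_sum - Ln (1 - q ^ Suc m)) UNIV"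
      by (simp add: z_def power_mult del: power_Suc mult_Suc)
  qed
  then show "(\<lambda>m. - Ln (1 - q ^ Suc m)) sums S"
    by (rule has_sum_imp_sums)
next
  let ?f = "\<lambda>(k, m). q ^ (Suc m * k) / of_nat k"
  \<comment> \<open>The vanishing terms with \<open>k = 0\<close> are dropped because only for
    \<open>k > 0\<close> is (k, m) determined by the pair of \<open>n = Suc m * k\<close> and its
    divisor \<open>k\<close>, namely through \<open>m = n div k - 1\<close>.\<close>
  have "(?f has_sum S) ({0<..} \<times> UNIV)"
    using S by (subst has_sum_cong_neutral[where T = "UNIV \<times> UNIV" and g = ?f]) auto
  also have "(?f has_sum S) ({0<..} \<times> UNIV) \<longleftrightarrow>
      ((\<lambda>(n, k). q ^ n / of_nat k) has_sum S) (Sigma {0<..} (\<lambda>n. {k. k dvd n}))"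
  proof (rule has_sum_reindex_bij_witness
        [where j = "\<lambda>(k, m). (Suc m * k, k)" and i = "\<lambda>(n, k). (k, n div k - 1)"])
    fix x :: "nat \<times> nat" assume "x \<in> Sigma {0<..} (\<lambda>n. {k. k dvd n})"
    then obtain n k where nk: "x = (n, k)" "n > 0" "k dvd n"
      by auto
    from nk(3) obtain d where "n = k * d"
      by (rule dvdE)
    with nk have x: "x = (d * k, k)" and "d * k > 0"
      by (simp_all add: mult.commute)
    then obtain e where "d = Suc e" "k > 0"
      by (cases d) auto
    with x have "x = (Suc e * k, k)" "k > 0"
      by simp_all
    then show "(case case x of (n, k) \<Rightarrow> (k, n div k - 1) of (k, m) \<Rightarrow> (Suc m * k, k)) = x"
      and "(case x of (n, k) \<Rightarrow> (k, n div k - 1)) \<in> {0<..} \<times> UNIV"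
      by (simp_all del: mult_Suc)
  next
    fix x :: "nat \<times> nat" assume "x \<in> {0<..} \<times> UNIV"
    then obtain k m where "x = (k, m)" "k > 0"
      by auto
    then show "(case case x of (k, m) \<Rightarrow> (Suc m * k, k) of (n, k) \<Rightarrow> (k, n div k - 1)) = x"
      and "(case x of (k, m) \<Rightarrow> (Suc m * k, k)) \<in> Sigma {0<..} (\<lambda>n. {k. k dvd n})"
      and "(case case x of (k, m) \<Rightarrow> (Suc m * k, k) of (n, k) \<Rightarrow> q ^ n / of_nat k) = ?f x"
      by (simp_all del: mult_Suc)
  qed simp
  finally have "((\<lambda>n. of_real (inv_div_sum n) * q ^ n) has_sum S) {0<..}"
  proof (rule has_sum_SigmaD)
    fix n :: nat assume "n \<in> {0<..}"
    then have "finite {k. k dvd n}"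
      by simp
    then show "((\<lambda>k. case (n, k) of (n, k) \<Rightarrow> q ^ n / of_nat k) has_sum
        of_real (inv_div_sum n) * q ^ n) {k. k dvd n}"
      by (intro has_sum_finiteI)
        (simp_all add: inv_div_sum_def sum_distrib_right)
  qed
  then have "((\<lambda>n. of_real (inv_div_sum n) * q ^ n) has_sum S) UNIV"
    by (subst has_sum_cong_neutral[where T = "{0<..}" and g = "\<lambda>n. of_real (inv_div_sum n) * q ^ n"]) auto
  then show "(\<lambda>n. of_real (inv_div_sum n) * q ^ n) sums S"
    by (rule has_sum_imp_sums)
qed

text \<open>Absolute summability is the real case at \<open>norm q\<close>.\<close>

lemma lambert_summable:
  fixes q :: complex
  assumes "norm q < 1"
  shows "(\<lambda>(k, m). q ^ (Suc m * k) / of_nat k) summable_on (UNIV \<times> UNIV)"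
proof (rule abs_summable_summable)
  obtain S where "((\<lambda>(k, m). norm q ^ (Suc m * k) / real k) has_sum S) (UNIV \<times> UNIV)"
    using lambert_has_sum[OF norm_ge_zero assms] by blast
  moreover have "(\<lambda>x. norm (case x of (k, m) \<Rightarrow> q ^ (Suc m * k) / of_nat k)) =
      (\<lambda>(k, m). norm q ^ (Suc m * k) / real k)"
    by (auto simp: norm_divide norm_power simp del: mult_Suc)
  ultimately show "(\<lambda>x. norm (case x of (k, m) \<Rightarrow> q ^ (Suc m * k) / of_nat k)) summable_on UNIV \<times> UNIV"
    by (simp only: has_sum_imp_summable)
qed

section \<open>Exponential form of the generating function and the recurrence\<close>

lemma pgen_eq_exp:
  fixes q :: complex
  assumes "norm q < 1"
    and "((\<lambda>(k, m). q ^ (Suc m * k) / of_nat k) has_sum S) (UNIV \<times> UNIV)"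
  shows "pgen \<alpha> q = exp (of_real \<alpha> * S)"
proof -
  have "(\<lambda>m. of_real \<alpha> * - Ln (1 - q ^ Suc m)) sums (of_real \<alpha> * S)"
    by (intro sums_mult lambert_sums(1) assms)
  then have "(\<lambda>m. exp (of_real \<alpha> * - Ln (1 - q ^ Suc m))) has_prod exp (of_real \<alpha> * S)"
    unfolding has_prod_def by (intro disjI1 sums_imp_has_prod_exp)
  then have "(\<lambda>m. (1 - q ^ Suc m) powr (- complex_of_real \<alpha>)) has_prod exp (of_real \<alpha> * S)"
    by (simp only: pgen_factor[OF assms(1)] minus_mult_commute)
  then show ?thesis
    unfolding pgen_def by (rule has_prod_unique[symmetric])
qed

lemma pnum_0 [simp]: "pnum \<alpha> 0 = 1"
proof -
  \<comment> \<open>For \<open>k > 0\<close> the power of 0 vanishes; for \<open>k = 0\<close> the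
    power is 1 but is divided by 0.\<close>
  have "((\<lambda>(k, m). 0 ^ (Suc m * k) / of_nat k) has_sum (0::complex)) (UNIV \<times> UNIV)"
    by (rule has_sum_0) (auto simp: power_0_left simp del: mult_Suc)
  then have "pgen \<alpha> 0 = 1"
    using pgen_eq_exp[of 0 0 \<alpha>] by (simp only: norm_zero zero_less_one mult_zero_right exp_zero)
  moreover have "(\<lambda>n. complex_of_real (pnum \<alpha> n) * 0 ^ n) sums pgen \<alpha> 0"
    by (rule pnum_sums) simp
  ultimately have "complex_of_real (pnum \<alpha> 0) = 1"
    by (simp only: powser_sums_zero_iff)
  then show ?thesis
    by simp
qed

text \<open>On the unit disc \<open>pgen \<alpha>\<close> is \<open>exp g\<close>, where
  \<open>g\<close> has coefficients \<open>\<alpha> * inv_div_sum n\<close>, so its derivative is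
  \<open>pgen \<alpha>\<close> times the derivative of \<open>g\<close>. The recurrence compares the
  coefficients of index \<open>n\<close>; \<open>k * inv_div_sum k\<close> is the divisor sum
  sigma(k).\<close>

lemma pnum_Suc:
  "real (Suc n) * pnum \<alpha> (Suc n) =
     \<alpha> * (\<Sum>i\<le>n. pnum \<alpha> i * (real (Suc n - i) * inv_div_sum (Suc n - i)))"
proof -
  define g where "g = (\<lambda>q::complex. \<Sum>n. complex_of_real (\<alpha> * inv_div_sum n) * q ^ n)"
  define F where "F = Abs_fps (\<lambda>n. complex_of_real (pnum \<alpha> n))"
  define G where "G = Abs_fps (\<lambda>n. complex_of_real (\<alpha> * inv_div_sum n))"
  have ev: "\<forall>\<^sub>F q in nhds (0::complex). q \<in> ball 0 1"
    by (rule eventually_nhds_in_open) auto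
  have key: "(\<lambda>n. complex_of_real (\<alpha> * inv_div_sum n) * q ^ n) sums g q \<and>
      pgen \<alpha> q = exp (g q)" if q: "norm q < 1" for q
  proof -
    obtain S where S: "((\<lambda>(k, m). q ^ (Suc m * k) / of_nat k) has_sum S) (UNIV \<times> UNIV)"
      using lambert_summable[OF q] unfolding summable_on_def by blast
    have "(\<lambda>n. of_real \<alpha> * (of_real (inv_div_sum n) * q ^ n)) sums (of_real \<alpha> * S)"
      by (intro sums_mult lambert_sums(2) q S)
    then have s: "(\<lambda>n. complex_of_real (\<alpha> * inv_div_sum n) * q ^ n) sums (of_real \<alpha> * S)"
      by (simp add: mult_ac)
    then show ?thesis
      unfolding g_def using sums_unique[OF s] pgen_eq_exp[OF q S] by simp
  qed
  have G: "g has_fps_expansion G"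
    unfolding G_def
    by (rule has_fps_expansionI, rule eventually_mono[OF ev]) (use key in simp)
  have F: "pgen \<alpha> has_fps_expansion F"
    unfolding F_def
    by (rule has_fps_expansionI, rule eventually_mono[OF ev]) (simp add: pnum_sums)
  have g_hol: "g holomorphic_on ball 0 1"
    by (rule power_series_holomorphic[where a = "\<lambda>n. complex_of_real (\<alpha> * inv_div_sum n)"])
      (use key in simp)
  have "deriv (pgen \<alpha>) q = pgen \<alpha> q * deriv g q" if q: "q \<in> ball 0 1" for q
  proof (rule DERIV_imp_deriv)
    have "(g has_field_derivative deriv g q) (at q)"
      using holomorphic_derivI[OF g_hol _ q] by simp
    then have "((\<lambda>q. exp (g q)) has_field_derivative exp (g q) * deriv g q) (at q)"
      by (rule DERIV_chain2[OF DERIV_exp])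
    moreover have "exp (g q) = pgen \<alpha> q"
      using key q by simp
    ultimately have "((\<lambda>q. exp (g q)) has_field_derivative pgen \<alpha> q * deriv g q) (at q)"
      by simp
    then show "(pgen \<alpha> has_field_derivative pgen \<alpha> q * deriv g q) (at q)"
      by (rule has_field_derivative_transform_within_open[OF _ open_ball q]) (use key in simp)
  qed
  then have eq: "\<forall>\<^sub>F q in nhds 0. pgen \<alpha> q * deriv g q = deriv (pgen \<alpha>) q"
    by (intro eventually_mono[OF ev]) simp
  have "(\<lambda>q. pgen \<alpha> q * deriv g q) has_fps_expansion F * fps_deriv G"
    by (intro has_fps_expansion_mult has_fps_expansion_deriv F G)
  then have "deriv (pgen \<alpha>) has_fps_expansion F * fps_deriv G"
    by (simp only: has_fps_expansion_cong[OF eq refl])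
  then have "fps_deriv F = F * fps_deriv G"
    using has_fps_expansion_deriv[OF F] fps_expansion_unique_complex by blast
  then have "fps_nth (fps_deriv F) n = fps_nth (F * fps_deriv G) n"
    by simp
  then have "complex_of_real (real (Suc n) * pnum \<alpha> (Suc n)) = complex_of_real
      (\<Sum>i=0..n. pnum \<alpha> i * (real (Suc (n - i)) * (\<alpha> * inv_div_sum (Suc (n - i)))))"
    by (simp add: F_def G_def fps_mult_nth)
  then have "real (Suc n) * pnum \<alpha> (Suc n) =
      (\<Sum>i=0..n. pnum \<alpha> i * (real (Suc (n - i)) * (\<alpha> * inv_div_sum (Suc (n - i)))))"
    unfolding of_real_eq_iff .
  then show ?thesis
    by (simp add: sum_distrib_left atMost_atLeast0 Suc_diff_le mult_ac)
qed

lemma pnum_pos: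
  assumes "\<alpha> > 0"
  shows "pnum \<alpha> n > 0"
proof (induction n rule: less_induct)
  case (less n)
  show ?case
  proof (cases n)
    case (Suc m)
    have "0 < (\<Sum>i\<le>m. pnum \<alpha> i * (real (Suc m - i) * inv_div_sum (Suc m - i)))"
    proof (rule sum_pos)
      fix i assume "i \<in> {..m}"
      then have "pnum \<alpha> i > 0" "Suc m - i > 0"
        using less Suc by auto
      then show "0 < pnum \<alpha> i * (real (Suc m - i) * inv_div_sum (Suc m - i))"
        using inv_div_sum_ge_1[of "Suc m - i"] by (intro mult_pos_pos) linarith+
    qed auto
    then have "0 < real (Suc m) * pnum \<alpha> (Suc m)"
      unfolding pnum_Suc using assms by (intro mult_pos_pos)
    then show ?thesis
      using Suc by (simp add: zero_less_mult_iff)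
  qed simp
qed

text \<open>The recurrence with sigma(k) replaced by its lower bound \<open>k\<close>, which is
  legitimate because all \<open>pnum\<close> values are positive.\<close>

lemma pnum_ge_convolution:
  assumes "\<alpha> > 0"
  shows "\<alpha> * (\<Sum>k=1..n. real k * pnum \<alpha> (n - k)) \<le> real n * pnum \<alpha> n"
proof (cases n)
  case (Suc m)
  have "(\<Sum>k=1..n. real k * pnum \<alpha> (n - k)) = (\<Sum>i\<le>m. pnum \<alpha> i * real (Suc m - i))"
    by (rule sum.reindex_bij_witness[of _ "\<lambda>i. Suc m - i" "\<lambda>k. Suc m - k"]) (auto simp: Suc)
  also have "\<dots> \<le> (\<Sum>i\<le>m. pnum \<alpha> i * (real (Suc m - i) * inv_div_sum (Suc m - i)))"
  proof (intro sum_mono mult_left_mono)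
    fix i assume "i \<in> {..m}"
    then have "inv_div_sum (Suc m - i) \<ge> 1"
      by (intro inv_div_sum_ge_1) auto
    then have "real (Suc m - i) * 1 \<le> real (Suc m - i) * inv_div_sum (Suc m - i)"
      by (rule mult_left_mono) simp
    then show "real (Suc m - i) \<le> real (Suc m - i) * inv_div_sum (Suc m - i)"
      by simp
  qed (use pnum_pos[OF assms] in \<open>auto intro: less_imp_le\<close>)
  finally show ?thesis
    unfolding Suc pnum_Suc using assms by (intro mult_left_mono) (simp_all add: Suc)
qed simp

section \<open>Lower bound, exponential in the square root\<close>

text \<open>The left side equals \<open>(x - y) / sqrt x\<close>, whose square is
  \<open>x - y\<close> times a ratio at most 1. It shows that lowering \<open>n\<close> by
  \<open>k \<le> M * sqrt n\<close> lowers the square root by at most \<open>M\<close>.\<close>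

lemma sqrt_diff_ge:
  fixes x y :: real
  assumes "0 \<le> y" "y \<le> x" "0 < x"
  shows "sqrt x - y / sqrt x \<le> sqrt (x - y)"
proof (rule real_le_rsqrt)
  have "sqrt x - y / sqrt x = (x - y) / sqrt x"
    using assms by (simp add: field_simps)
  then have "(sqrt x - y / sqrt x)\<^sup>2 = (x - y) * ((x - y) / x)"
    using assms by (simp add: power_divide power2_eq_square)
  also have "\<dots> \<le> (x - y) * 1"
    using assms by (intro mult_left_mono) simp_all
  finally show "(sqrt x - y / sqrt x)\<^sup>2 \<le> x - y"
    by simp
qed

text \<open>
  With \<open>c = 1 / M\<close>, the bound for the \<open>k\<close>-th term of the convolution loses at most a factor \<open>e\<close>
  for \<open>k \<le> M * sqrt n\<close>, and these \<open>k\<close> add up to at least \<open>M\<^sup>2 * n / 4\<close>. So the induction closes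
  as soon as \<open>\<alpha> * M\<^sup>2 \<ge> 4 * e\<close>.
\<close>
lemma pnum_lower_bound:
  assumes "\<alpha> > 0"
  obtains c \<delta> where "c > 0" "\<delta> > 0" "\<And>n. \<delta> * exp (c * sqrt (real n)) \<le> pnum \<alpha> n"
proof -
  \<comment> \<open>The summand 1 forces \<open>M > 1\<close>, hence \<open>M \<le> M ^ 2\<close>,
    so that a bound linear in \<open>M\<close> already gives the condition on
    \<open>M ^ 2\<close>.\<close>
  obtain M :: nat where M: "4 * exp 1 / \<alpha> + 1 < real M"
    using reals_Archimedean2 by blast
  moreover have "4 * exp 1 / \<alpha> > 0"
    using assms by simp
  ultimately have M1: "real M > 1"
    by linarith
  have "4 * exp 1 / \<alpha> \<le> real M"
    using M by linarith
  also have "\<dots> \<le> real M ^ 2"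
    using M1 by (simp add: power2_eq_square)
  finally have M2: "4 * exp 1 \<le> \<alpha> * real M ^ 2"
    using assms by (simp add: field_simps)
  \<comment> \<open>This is the largest constant for which the claim holds at every \<open>n\<close>
    up to \<open>M ^ 2\<close>; these \<open>n\<close> form the base of the induction.\<close>
  define \<delta> where "\<delta> = Min ((\<lambda>m. pnum \<alpha> m * exp (- (sqrt (real m) / M))) ` {..M\<^sup>2})"
  have \<delta>: "\<delta> > 0"
    unfolding \<delta>_def using pnum_pos[OF assms] by (subst Min_gr_iff) auto
  have "\<delta> * exp (sqrt (real n) / M) \<le> pnum \<alpha> n" for n
  proof (induction n rule: less_induct)
    case (less n)
    show ?case
    proof (cases "n \<le> M\<^sup>2")
      case True
      then have "\<delta> \<le> pnum \<alpha> n * exp (- (sqrt (real n) / M))"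
        unfolding \<delta>_def by (intro Min_le) auto
      then show ?thesis
        by (simp add: exp_minus field_simps)
    next
      case False
      define s where "s = sqrt (real n)"
      \<comment> \<open>The convolution is cut off at \<open>K\<close>. Since
        \<open>n > M ^ 2\<close> means \<open>M < s\<close>, the cutoff satisfies
        \<open>K \<le> M * s \<le> s * s = n\<close>.\<close>
      define K where "K = nat \<lfloor>M * s\<rfloor>"
      have "real (M ^ 2) < real n"
        using False by (simp only: of_nat_less_iff not_le)
      then have n: "real M ^ 2 < real n"
        by simp
      then have Ms: "real M < s"
        unfolding s_def by (rule real_less_rsqrt)
      have s2: "s * s = real n"
        by (simp add: s_def)
      have n0: "real n > 0"
        using n by (smt (verit) zero_le_power2)
      have s1: "s > 1"
        using Ms M1 by linarith
      have K: "real K \<le> M * s" "M * s < real K + 1"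
        unfolding K_def using s1 by (simp_all add: of_nat_floor)
      have "real M * s \<le> s * s"
        using Ms s1 by (intro mult_right_mono) auto
      then have Kn: "K \<le> n"
        using K s2 by linarith
      have "real M * s > 1"
        using M1 s1 less_1_mult by blast
      then have K1: "K \<ge> 1"
        using K by linarith
      \<comment> \<open>As \<open>K \<ge> 1\<close>, \<open>K + 1 \<le> 2 * K\<close>; hence
        \<open>(K + 1) ^ 2\<close> is at most four times the Gauss sum
        \<open>K * (K + 1) / 2\<close>.\<close>
      have "real M ^ 2 * real n = (M * s) ^ 2"
        by (simp add: power2_eq_square s2[symmetric] mult_ac)
      also have "\<dots> \<le> (real K + 1) ^ 2"
        using K s1 by (intro power_mono) auto
      also have "\<dots> \<le> (real K + 1) * (2 * real K)"
        unfolding power2_eq_square using K1 by (intro mult_left_mono) auto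
      also have "\<dots> = 4 * (\<Sum>k=1..K. real k)"
        using double_gauss_sum_from_Suc_0[of K, where 'a = real] by (simp add: algebra_simps)
      finally have sum_ge: "real M ^ 2 * real n / 4 \<le> (\<Sum>k=1..K. real k)"
        by simp
      have summand_ge: "\<delta> * exp (s / M - 1) \<le> pnum \<alpha> (n - k)" if k: "k \<in> {1..K}" for k
      proof -
        have "real k \<le> M * s"
          using k K by (smt (verit) atLeastAtMost_iff of_nat_le_iff)
        then have "real k / s \<le> M"
          using s1 by (simp add: field_simps)
        moreover have "s - real k / s \<le> sqrt (real (n - k))"
          unfolding s_def using k Kn n0 sqrt_diff_ge[of "real k" "real n"] by (simp add: of_nat_diff)
        ultimately have "s - M \<le> sqrt (real (n - k))"
          by linarith
        then have "s / M - 1 \<le> sqrt (real (n - k)) / M"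
          using M1 divide_right_mono[of "s - M" "sqrt (real (n - k))" "real M"]
          by (simp add: diff_divide_distrib)
        then have "\<delta> * exp (s / M - 1) \<le> \<delta> * exp (sqrt (real (n - k)) / M)"
          using \<delta> by simp
        also have "\<dots> \<le> pnum \<alpha> (n - k)"
          using k Kn by (intro less) auto
        finally show ?thesis .
      qed
      \<comment> \<open>In the constant \<open>4 * exp 1\<close>, the factor \<open>exp 1\<close>
        restores the 1 lost in the exponent and the 4 matches the quarter in
        \<open>sum_ge\<close>.\<close>
      have "real n * (\<delta> * exp (s / M)) = (4 * exp 1) * (real n / 4 * (\<delta> * exp (s / M - 1)))"
        by (simp add: exp_diff)
      also have "\<dots> \<le> (\<alpha> * real M ^ 2) * (real n / 4 * (\<delta> * exp (s / M - 1)))"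
        using \<delta> by (intro mult_right_mono[OF M2]) auto
      also have "\<dots> = \<alpha> * (real M ^ 2 * real n / 4 * (\<delta> * exp (s / M - 1)))"
        by simp
      also have "\<dots> \<le> \<alpha> * ((\<Sum>k=1..K. real k) * (\<delta> * exp (s / M - 1)))"
        using assms \<delta> by (intro mult_left_mono mult_right_mono sum_ge) auto
      also have "\<dots> = \<alpha> * (\<Sum>k=1..K. real k * (\<delta> * exp (s / M - 1)))"
        by (simp only: sum_distrib_right)
      also have "\<dots> \<le> \<alpha> * (\<Sum>k=1..K. real k * pnum \<alpha> (n - k))"
        using assms by (intro mult_left_mono sum_mono summand_ge) auto
      also have "\<dots> \<le> \<alpha> * (\<Sum>k=1..n. real k * pnum \<alpha> (n - k))"
        using assms Kn less_imp_le[OF pnum_pos[OF assms]]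
        by (intro mult_left_mono sum_mono2) auto
      also have "\<dots> \<le> real n * pnum \<alpha> n"
        by (rule pnum_ge_convolution[OF assms])
      finally show ?thesis
        using n0 by (simp add: s_def)
    qed
  qed
  with \<delta> M1 show thesis
    by (intro that[of "1 / M" \<delta>]) auto
qed

section \<open>Upper bound, exponential in the square root\<close>

text \<open>The coefficients are positive, so a single term of the power series at \<open>r\<close>
  is at most its sum \<open>exp (\<alpha> * S)\<close>, and \<open>lambert_has_sum\<close> bounds
  \<open>S\<close>.\<close>

lemma pnum_power_le:
  assumes "\<alpha> > 0" "0 \<le> r" "r < 1"
  shows "pnum \<alpha> n * r ^ n \<le> exp (\<alpha> * ((\<Sum>k. 1 / real k ^ 2) * (r / (1 - r))))"
proof -
  obtain S where S: "((\<lambda>(k, m). r ^ (Suc m * k) / real k) has_sum S) (UNIV \<times> UNIV)"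
    and le: "S \<le> (\<Sum>k. 1 / real k ^ 2) * (r / (1 - r))"
    using lambert_has_sum[OF assms(2,3)] .
  have q: "norm (complex_of_real r) < 1"
    using assms by simp
  have "((\<lambda>x. complex_of_real (case x of (k, m) \<Rightarrow> r ^ (Suc m * k) / real k)) has_sum
      of_real S) (UNIV \<times> UNIV)"
    by (rule has_sum_of_real[OF S])
  also have "(\<lambda>x. complex_of_real (case x of (k, m) \<Rightarrow> r ^ (Suc m * k) / real k)) =
      (\<lambda>(k, m). of_real r ^ (Suc m * k) / of_nat k)"
    by (auto simp del: mult_Suc)
  finally have "pgen \<alpha> (of_real r) = exp (of_real \<alpha> * of_real S)"
    by (rule pgen_eq_exp[OF q])
  then have "pgen \<alpha> (of_real r) = of_real (exp (\<alpha> * S))"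
    by (simp flip: exp_of_real)
  then have "(\<lambda>n. complex_of_real (pnum \<alpha> n * r ^ n)) sums of_real (exp (\<alpha> * S))"
    using pnum_sums[OF q, of \<alpha>] by simp
  then have sums: "(\<lambda>n. pnum \<alpha> n * r ^ n) sums exp (\<alpha> * S)"
    by (simp only: sums_of_real_iff)
  have "(\<Sum>i\<in>{n}. pnum \<alpha> i * r ^ i) \<le> exp (\<alpha> * S)"
    unfolding sums_unique[OF sums]
    by (intro sum_le_suminf sums_summable[OF sums])
      (use assms less_imp_le[OF pnum_pos[OF assms(1)]] in auto)
  also have "\<dots> \<le> exp (\<alpha> * ((\<Sum>k. 1 / real k ^ 2) * (r / (1 - r))))"
    unfolding exp_le_cancel_iff using assms(1) by (intro mult_left_mono le) simp
  finally show ?thesis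
    by simp
qed

lemma pnum_upper_bound:
  assumes "\<alpha> > 0"
  obtains C where "C > 0" "\<And>n. pnum \<alpha> n \<le> exp (C * sqrt (real n))"
proof -
  define Z where "Z = (\<Sum>k. 1 / real k ^ 2)"
  have "summable (\<lambda>k. 1 / real k ^ 2)"
    using inverse_power_summable[of 2, where 'a = real] by (simp add: inverse_eq_divide)
  then have "Z \<ge> 0"
    unfolding Z_def by (rule suminf_nonneg) simp
  then have pos: "1 + \<alpha> * Z > 0"
    using assms by (simp add: add_pos_nonneg)
  have "pnum \<alpha> n \<le> exp ((1 + \<alpha> * Z) * sqrt (real n))" for n
  proof (cases "n = 0")
    case False
    define s where "s = sqrt (real n)"
    have s: "s > 0" "s * s = real n"
      using False by (simp_all add: s_def)
    \<comment> \<open>This choice balances two costs: \<open>r / (1 - r)\<close> becomes exactly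
      \<open>s\<close>, and dividing by \<open>r ^ n\<close> costs \<open>(1 + 1 / s) ^ n\<close>,
      which is at most \<open>exp (n / s) = exp s\<close>.\<close>
    define r where "r = 1 / (1 + 1 / s)"
    have r: "0 < r" "r < 1" "r / (1 - r) = s"
      using s(1) by (simp_all add: r_def field_simps)
    have "pnum \<alpha> n * r ^ n \<le> exp (\<alpha> * (Z * s))"
      using pnum_power_le[OF assms, of r n] r by (simp add: Z_def)
    moreover have "r * (1 + 1 / s) = 1"
    proof -
      have "1 + 1 / s \<noteq> 0"
        using s(1) by (smt (verit) divide_pos_pos)
      then show ?thesis
        by (simp add: r_def)
    qed
    then have "r ^ n * (1 + 1 / s) ^ n = 1"
      by (simp flip: power_mult_distrib)
    ultimately have "pnum \<alpha> n \<le> exp (\<alpha> * (Z * s)) * (1 + 1 / s) ^ n"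
      using mult_right_mono[of "pnum \<alpha> n * r ^ n" "exp (\<alpha> * (Z * s))" "(1 + 1 / s) ^ n"] s(1)
      by (simp add: mult.assoc)
    also have "\<dots> \<le> exp (\<alpha> * (Z * s)) * exp (1 / s) ^ n"
      using s(1) by (intro mult_left_mono power_mono) auto
    also have "exp (1 / s) ^ n = exp s"
      using s by (simp add: field_simps flip: exp_of_nat_mult)
    finally show ?thesis
      by (simp add: s_def algebra_simps flip: exp_add)
  qed simp
  with pos show thesis
    by (rule that)
qed

section \<open>Comparison of the two products\<close>

text \<open>A strict inequality serves both directions of the theorem: it implies the weak one, and
  with the two pairs exchanged it refutes it. The left product is at most
  \<open>exp ((C + C') * sqrt n3)\<close>, because \<open>n4 \<le> n3\<close>; the right one is at
  least a constant times \<open>exp (c * sqrt n1)\<close>.\<close>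

lemma pnum_product_less:
  fixes n1 n2 n3 n4 :: "nat \<Rightarrow> nat"
  assumes \<alpha>: "\<alpha>1 > 0" "\<alpha>2 > 0" "\<alpha>3 > 0" "\<alpha>4 > 0"
    and le: "\<And>t. n4 t \<le> n3 t"
    and lim: "filterlim n1 at_top F" "((\<lambda>t. real (n3 t) / real (n1 t)) \<longlongrightarrow> 0) F"
  shows "\<forall>\<^sub>F t in F. pnum \<alpha>3 (n3 t) * pnum \<alpha>4 (n4 t) < pnum \<alpha>1 (n1 t) * pnum \<alpha>2 (n2 t)"
proof -
  obtain c \<delta> where c: "c > 0" "\<delta> > 0" "\<And>n. \<delta> * exp (c * sqrt (real n)) \<le> pnum \<alpha>1 n"
    by (rule pnum_lower_bound[OF \<alpha>(1)]) (rule that)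
  obtain c' \<delta>' where c': "c' > 0" "\<delta>' > 0" "\<And>n. \<delta>' * exp (c' * sqrt (real n)) \<le> pnum \<alpha>2 n"
    by (rule pnum_lower_bound[OF \<alpha>(2)]) (rule that)
  obtain C where C: "C > 0" "\<And>n. pnum \<alpha>3 n \<le> exp (C * sqrt (real n))"
    by (rule pnum_upper_bound[OF \<alpha>(3)]) (rule that)
  obtain C' where C': "C' > 0" "\<And>n. pnum \<alpha>4 n \<le> exp (C' * sqrt (real n))"
    by (rule pnum_upper_bound[OF \<alpha>(4)]) (rule that)
  \<comment> \<open>Once \<open>sqrt n3 < d * sqrt n1\<close>, the left exponent stays below
    \<open>c / 2 * sqrt n1\<close>, and the other half of \<open>c * sqrt n1\<close> is left to
    absorb the constant \<open>ln (\<delta> * \<delta>')\<close>.\<close>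
  define d where "d = c / (2 * (C + C'))"
  have d: "d > 0" "(C + C') * d = c / 2"
    using c C C' by (simp_all add: d_def field_simps)
  have "filterlim (\<lambda>t. sqrt (real (n1 t))) at_top F"
    by (intro filterlim_compose[OF sqrt_at_top] filterlim_compose[OF filterlim_real_sequentially] lim(1))
  \<comment> \<open>The 0 in the maximum makes \<open>n1\<close> positive, so that the quotient
    bound can be multiplied out; the other entry is the threshold beyond which
    \<open>c / 2 * sqrt n1\<close> exceeds \<open>- ln (\<delta> * \<delta>')\<close>.\<close>
  then have "\<forall>\<^sub>F t in F. sqrt (real (n1 t)) > max 0 (- (2 / c) * ln (\<delta> * \<delta>'))"
    unfolding filterlim_at_top_dense by blast
  moreover have "\<forall>\<^sub>F t in F. real (n3 t) / real (n1 t) < d\<^sup>2"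
    using d(1) by (intro order_tendstoD(2)[OF lim(2)]) simp
  ultimately show ?thesis
  proof eventually_elim
    case (elim t)
    have n1: "real (n1 t) > 0" and large: "- (2 / c) * ln (\<delta> * \<delta>') < sqrt (real (n1 t))"
      using elim(1) by simp_all
    have "real (n3 t) < d\<^sup>2 * real (n1 t)"
      using elim(2) n1 by (simp add: field_simps)
    then have "sqrt (real (n3 t)) < sqrt (d\<^sup>2 * real (n1 t))"
      by (rule real_sqrt_less_mono)
    then have "sqrt (real (n3 t)) < d * sqrt (real (n1 t))"
      using d(1) by (simp add: real_sqrt_mult)
    then have "(C + C') * sqrt (real (n3 t)) < (C + C') * (d * sqrt (real (n1 t)))"
      using C C' by (intro mult_strict_left_mono) auto
    then have n3: "(C + C') * sqrt (real (n3 t)) < c / 2 * sqrt (real (n1 t))"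
      by (simp only: d(2) flip: mult.assoc)
    have "c / 2 * (- (2 / c) * ln (\<delta> * \<delta>')) < c / 2 * sqrt (real (n1 t))"
      using c large by (intro mult_strict_left_mono) auto
    then have n1': "0 < ln (\<delta> * \<delta>') + c / 2 * sqrt (real (n1 t))"
      using c by simp
    have "pnum \<alpha>3 (n3 t) * pnum \<alpha>4 (n4 t) \<le> exp (C * sqrt (real (n3 t))) * exp (C' * sqrt (real (n4 t)))"
      using pnum_pos[OF \<alpha>(4)] by (intro mult_mono C C') (auto intro: less_imp_le)
    also have "\<dots> \<le> exp (C * sqrt (real (n3 t))) * exp (C' * sqrt (real (n3 t)))"
      using C' le by simp
    also have "\<dots> = exp ((C + C') * sqrt (real (n3 t)))"
      by (simp add: algebra_simps exp_add)
    also have "\<dots> < exp (ln (\<delta> * \<delta>') + c * sqrt (real (n1 t)))"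
      using n3 n1' by simp
    \<comment> \<open>From the factor at \<open>n2\<close> only the constant
      \<open>\<delta>'\<close> is needed, since its exponential is at least 1 whatever the size of
      \<open>n2\<close>.\<close>
    also have "\<dots> = \<delta> * exp (c * sqrt (real (n1 t))) * (\<delta>' * 1)"
      using c c' by (simp add: exp_add)
    also have "\<dots> \<le> \<delta> * exp (c * sqrt (real (n1 t))) * (\<delta>' * exp (c' * sqrt (real (n2 t))))"
      using c c' by (intro mult_left_mono) auto
    also have "\<dots> \<le> pnum \<alpha>1 (n1 t) * pnum \<alpha>2 (n2 t)"
      using c c' pnum_pos[OF \<alpha>(1)] by (intro mult_mono) (auto intro: less_imp_le)
    finally show ?case .
  qed
qed

theorem theorem1p1:
  fixes \<alpha>1 \<alpha>2 \<alpha>3 \<alpha>4 :: real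
    and n1 n2 n3 n4 :: "nat \<Rightarrow> nat"
  assumes "\<alpha>1 > 0" "\<alpha>2 > 0" "\<alpha>3 > 0" "\<alpha>4 > 0"
    and "\<And>t. n1 t > 0" "\<And>t. n2 t > 0" "\<And>t. n3 t > 0" "\<And>t. n4 t > 0"
    and "\<And>t. n1 t \<ge> n2 t" "\<And>t. n3 t \<ge> n4 t"
  shows "(filterlim n1 at_top sequentially \<and>
            (\<lambda>t. real (n3 t) / real (n1 t)) \<longlonglongrightarrow> 0 \<longrightarrow>
          (\<forall>\<^sub>F t in sequentially.
             pnum \<alpha>1 (n1 t) * pnum \<alpha>2 (n2 t) \<ge> pnum \<alpha>3 (n3 t) * pnum \<alpha>4 (n4 t)))
       \<and> (filterlim n3 at_top sequentially \<and>
            (\<lambda>t. real (n1 t) / real (n3 t)) \<longlonglongrightarrow> 0 \<longrightarrow>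
          (\<forall>\<^sub>F t in sequentially.
             \<not> (pnum \<alpha>1 (n1 t) * pnum \<alpha>2 (n2 t) \<ge> pnum \<alpha>3 (n3 t) * pnum \<alpha>4 (n4 t))))"
proof (intro conjI impI; elim conjE)
  assume "filterlim n1 at_top sequentially" "(\<lambda>t. real (n3 t) / real (n1 t)) \<longlonglongrightarrow> 0"
  then have "\<forall>\<^sub>F t in sequentially.
      pnum \<alpha>3 (n3 t) * pnum \<alpha>4 (n4 t) < pnum \<alpha>1 (n1 t) * pnum \<alpha>2 (n2 t)"
    by (intro pnum_product_less assms)
  then show "\<forall>\<^sub>F t in sequentially.
      pnum \<alpha>1 (n1 t) * pnum \<alpha>2 (n2 t) \<ge> pnum \<alpha>3 (n3 t) * pnum \<alpha>4 (n4 t)"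
    by (rule eventually_mono) simp
next
  \<comment> \<open>The same comparison applies with the pairs exchanged, now using
    \<open>n2 \<le> n1\<close> for the smaller product.\<close>
  assume "filterlim n3 at_top sequentially" "(\<lambda>t. real (n1 t) / real (n3 t)) \<longlonglongrightarrow> 0"
  then have "\<forall>\<^sub>F t in sequentially.
      pnum \<alpha>1 (n1 t) * pnum \<alpha>2 (n2 t) < pnum \<alpha>3 (n3 t) * pnum \<alpha>4 (n4 t)"
    by (intro pnum_product_less assms)
  then show "\<forall>\<^sub>F t in sequentially.
      \<not> (pnum \<alpha>1 (n1 t) * pnum \<alpha>2 (n2 t) \<ge> pnum \<alpha>3 (n3 t) * pnum \<alpha>4 (n4 t))"
    by (rule eventually_mono) simp
qed

end
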